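(* Let $W$ be a random variable with values in $(0,1)$ such that the distribution of $|\log W|$ is non-lattice, and let $L_n$ be the number of empty boxes within the occupancy range when $n$ balls are allocated by the Bernoulli sieve driven by $W$. If $W$ and $1-W$ have the same distribution, then for every $n\in\{1,2,\dots\}$ the variable $L_n$ is geometrically distributed with parameter $1/2$, i.e. $$\mathbb{P}\{L_n=k\}=2^{-k-1},\qquad k=0,1,2,\dots$$
   Context: Bernoulli sieve: let $W_1,W_2,\dots$ be independent copies of $W$. The random frequencies of the boxes $k=1,2,\dots$ are $p_k:=W_1W_2\cdots W_{k-1}(1-W_k)$; they are positive and sum to $1$ almost surely. Given $(W_k)$, balls $1,2,\dots$ are thrown independently, each falling in box $k$ with probability $p_k$. For the first $n$ balls, $K_n$ is the number of boxes containing at least one ball, $M_n$ is the maximal index of an occupied box, and $L_n:=M_n-K_n$ is the number of empty boxes with index at most $M_n$. The distribution of $|\log W|$ is non-lattice if it is not concentrated on $d\mathbb{Z}$ for any $d>0$. *)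

theory Defs
  imports "HOL-Probability.Probability"
begin

definition non_lattice :: "real measure \<Rightarrow> bool" where
  "non_lattice \<mu> \<longleftrightarrow> (\<forall>d>0. \<not> (AE x in \<mu>. \<exists>z::int. x = d * of_int z))"

definition cond_indep_vars ::
  "'a measure \<Rightarrow> 'a measure \<Rightarrow> ('i \<Rightarrow> 'b measure) \<Rightarrow> ('i \<Rightarrow> 'a \<Rightarrow> 'b) \<Rightarrow> 'i set \<Rightarrow> bool" where
  "cond_indep_vars M F M' X I \<longleftrightarrow>
     (\<forall>i\<in>I. X i \<in> measurable M (M' i)) \<and>
     (\<forall>J A. finite J \<longrightarrow> J \<subseteq> I \<longrightarrow> (\<forall>i\<in>J. A i \<in> sets (M' i)) \<longrightarrow>
        (AE \<omega> in M. real_cond_exp M F (indicator {\<omega> \<in> space M. \<forall>i\<in>J. X i \<omega> \<in> A i}) \<omega>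
           = (\<Prod>i\<in>J. real_cond_exp M F (indicator {\<omega> \<in> space M. X i \<omega> \<in> A i}) \<omega>)))"

text \<open>The sequences of factors, boxes and balls are all indexed by the positive integers;
  values at index \<open>0\<close> are irrelevant.\<close>

definition freq :: "(nat \<Rightarrow> 'a \<Rightarrow> real) \<Rightarrow> nat \<Rightarrow> 'a \<Rightarrow> real" where
  "freq Ws k \<omega> = (\<Prod>j\<in>{1..<k}. Ws j \<omega>) * (1 - Ws k \<omega>)"

definition env_algebra :: "'a measure \<Rightarrow> (nat \<Rightarrow> 'a \<Rightarrow> real) \<Rightarrow> 'a measure" where
  "env_algebra M Ws =
     vimage_algebra (space M) (\<lambda>\<omega>. \<lambda>k\<in>{1..}. Ws k \<omega>) (\<Pi>\<^sub>M k\<in>{1..}. (borel :: real measure))"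

text \<open>\<open>W\<close> lives on its own probability space \<open>N\<close> and serves only to prescribe the law of its
  copies \<open>Ws 1, Ws 2, \<dots>\<close> on \<open>M\<close>; \<open>X i \<omega>\<close> is the box that receives ball \<open>i\<close>.\<close>

locale bernoulli_sieve = prob_space M
  for N :: "'b measure" and W :: "'b \<Rightarrow> real"
    and M :: "'a measure" and Ws :: "nat \<Rightarrow> 'a \<Rightarrow> real" and X :: "nat \<Rightarrow> 'a \<Rightarrow> nat" +
  assumes indep_Ws: "indep_vars (\<lambda>_. borel) Ws {1..}"
    and distr_Ws: "\<And>k. k \<ge> 1 \<Longrightarrow> distr M borel (Ws k) = distr N borel W"
    and cond_indep_balls:
      "cond_indep_vars M (env_algebra M Ws) (\<lambda>_. count_space {1..}) X {1..}"
    and cond_prob_ball: "\<And>i k. i \<ge> 1 \<Longrightarrow> k \<ge> 1 \<Longrightarrow>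
      AE \<omega> in M. real_cond_exp M (env_algebra M Ws) (indicator {\<omega> \<in> space M. X i \<omega> = k}) \<omega>
        = freq Ws k \<omega>"

definition occupied_boxes :: "(nat \<Rightarrow> 'a \<Rightarrow> nat) \<Rightarrow> nat \<Rightarrow> 'a \<Rightarrow> nat set" where
  "occupied_boxes X n \<omega> = (\<lambda>i. X i \<omega>) ` {1..n}"

definition num_occupied :: "(nat \<Rightarrow> 'a \<Rightarrow> nat) \<Rightarrow> nat \<Rightarrow> 'a \<Rightarrow> nat" where
  "num_occupied X n \<omega> = card (occupied_boxes X n \<omega>)"

definition max_occupied :: "(nat \<Rightarrow> 'a \<Rightarrow> nat) \<Rightarrow> nat \<Rightarrow> 'a \<Rightarrow> nat" where
  "max_occupied X n \<omega> = Max (occupied_boxes X n \<omega>)"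

text \<open>For \<open>n \<ge> 1\<close> the subtraction below does not truncate: the occupied boxes all lie in
  \<open>{1..max_occupied X n \<omega>}\<close>.\<close>

definition num_empty :: "(nat \<Rightarrow> 'a \<Rightarrow> nat) \<Rightarrow> nat \<Rightarrow> 'a \<Rightarrow> nat" where
  "num_empty X n \<omega> = max_occupied X n \<omega> - num_occupied X n \<omega>"

end

theory Submission
  imports Defs
begin

text \<open>The law of the allocation of the first \<open>n\<close> balls is explicit: integrating out the
  factors, an allocation \<open>x\<close> has probability \<open>\<Prod>k. E (W ^ a\<^sub>k * (1 - W) ^ b\<^sub>k)\<close>, where \<open>a\<^sub>k\<close> and
  \<open>b\<^sub>k\<close> count the balls beyond and in box \<open>k\<close>. Splitting off the set of balls in box 1 gives a
  recursion for the law of \<open>L\<^sub>n\<close>: the remaining balls perform a Bernoulli sieve of their own, and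
  one empty box is gained exactly if box 1 is empty. By the symmetry of \<open>W\<close>, the events that
  box 1 gets no ball and that it gets all balls have the same probability \<open>q\<close>, and the geometric
  law solves the recursion because \<open>(1 - 2 * q) / 2 + q = 1 / 2\<close>.\<close>

section \<open>Allocations of finitely many balls\<close>

text \<open>The inserted 0 gives the empty set of balls top box 0, so that its weight is an empty
  product and splitting off boxes ends there.\<close>

definition top_box :: "'i set \<Rightarrow> ('i \<Rightarrow> nat) \<Rightarrow> nat" where
  "top_box A x = Max (insert 0 (x ` A))"

text \<open>Here \<open>k\<close> is the number of empty boxes below the top one. The additive form
  avoids truncated subtraction, and extensionality makes an allocation determined by its values on
  \<open>A\<close>.\<close>

definition allocations :: "'i set \<Rightarrow> nat \<Rightarrow> ('i \<Rightarrow> nat) set" where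
  "allocations A k = {x \<in> A \<rightarrow>\<^sub>E {1..}. top_box A x = k + card (x ` A)}"

text \<open>Leaving \<open>\<mu>\<close> abstract separates combinatorics from probability: later
  only its symmetry and total mass 1 are used.\<close>

definition allocation_weight :: "(nat \<Rightarrow> nat \<Rightarrow> real) \<Rightarrow> 'i set \<Rightarrow> ('i \<Rightarrow> nat) \<Rightarrow> real" where
  "allocation_weight \<mu> A x =
     (\<Prod>k\<in>{1..top_box A x}. \<mu> (card {i\<in>A. k < x i}) (card {i\<in>A. x i = k}))"

definition put_first :: "'i set \<Rightarrow> 'i set \<Rightarrow> ('i \<Rightarrow> nat) \<Rightarrow> 'i \<Rightarrow> nat" where
  "put_first A B y = (\<lambda>i\<in>A. if i \<in> B then 1 else Suc (y i))"

text \<open>At most \<open>card A\<close> boxes are occupied and \<open>k\<close> are empty, so no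
  ball lies beyond box \<open>k + card A\<close>.\<close>

lemma finite_allocations:
  assumes "finite A"
  shows "finite (allocations A k)"
proof (rule finite_subset)
  show "allocations A k \<subseteq> A \<rightarrow>\<^sub>E {1..k + card A}"
  proof
    fix x assume x: "x \<in> allocations A k"
    have "x i \<le> k + card A" if "i \<in> A" for i
    proof -
      have "x i \<le> top_box A x" using that assms by (auto simp: top_box_def)
      also have "\<dots> = k + card (x ` A)" using x by (simp add: allocations_def)
      also have "\<dots> \<le> k + card A" using assms by (simp add: card_image_le)
      finally show ?thesis .
    qed
    then show "x \<in> A \<rightarrow>\<^sub>E {1..k + card A}"
      using x by (auto simp: allocations_def PiE_iff)
  qed
  show "finite (A \<rightarrow>\<^sub>E {1..k + card A})" using assms by (simp add: finite_PiE)
qed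

lemma allocations_empty: "allocations {} k = (if k = 0 then {\<lambda>_. undefined} else {})"
  by (auto simp: allocations_def top_box_def)

section \<open>Splitting off the balls in box 1\<close>

lemma put_first_image:
  assumes "B \<subseteq> A"
  shows "put_first A B y ` A = (if B = {} then {} else {1}) \<union> Suc ` y ` (A - B)"
proof -
  have "put_first A B y ` A = put_first A B y ` B \<union> put_first A B y ` (A - B)"
    using assms by blast
  moreover have "put_first A B y ` B = (\<lambda>_. 1) ` B"
    using assms by (intro image_cong) (auto simp: put_first_def)
  moreover have "put_first A B y ` (A - B) = Suc ` y ` (A - B)"
    unfolding image_image by (intro image_cong) (auto simp: put_first_def)
  ultimately show ?thesis by auto
qed

lemma top_box_put_first:
  assumes "finite A" "B \<subseteq> A" "A \<noteq> {}"
  shows "top_box A (put_first A B y) = Suc (top_box (A - B) y)"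
proof -
  have "Suc (top_box (A - B) y) = Max (Suc ` insert 0 (y ` (A - B)))"
    unfolding top_box_def using assms by (intro mono_Max_commute) (auto simp: mono_def)
  also have "\<dots> = Max (insert 0 (put_first A B y ` A))"
  proof (rule antisym; rule Max.boundedI)
    fix z assume "z \<in> Suc ` insert 0 (y ` (A - B))"
    then show "z \<le> Max (insert 0 (put_first A B y ` A))"
    proof (elim imageE insertE)
      \<comment> \<open>The inserted 0 is shifted to 1, which need not be an occupied box if
        \<open>B\<close> is empty; any ball of \<open>A\<close> still lies in a box of index at
        least 1.\<close>
      fix w assume w: "z = Suc w" "w = 0"
      obtain a where a: "a \<in> A" using assms by blast
      then have "z \<le> put_first A B y a" using w by (simp add: put_first_def)
      also have "\<dots> \<le> Max (insert 0 (put_first A B y ` A))"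
        using a assms by (intro Max_ge) auto
      finally show ?thesis .
    next
      fix w i assume "z = Suc w" "w = y i" "i \<in> A - B"
      then show ?thesis using assms
        by (intro Max_ge) (auto simp: put_first_image)
    qed
  next
    fix z assume "z \<in> insert 0 (put_first A B y ` A)"
    then consider "z = 0" | "z = 1" | "z \<in> Suc ` y ` (A - B)"
      using assms by (auto simp: put_first_image split: if_splits)
    then show "z \<le> Max (Suc ` insert 0 (y ` (A - B)))"
      using assms by cases (auto intro: Max_ge)
  qed (use assms in auto)
  finally show ?thesis by (simp add: top_box_def)
qed

text \<open>Shifted boxes start at 2, so box 1 is never counted twice. Since the top box always
  rises by one, an empty box is gained exactly when \<open>B\<close> is empty.\<close>

lemma card_put_first_image:
  assumes "finite A" "B \<subseteq> A" "y \<in> (A - B) \<rightarrow> {1..}"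
  shows "card (put_first A B y ` A) = card (y ` (A - B)) + (if B = {} then 0 else 1)"
proof -
  have "1 \<notin> Suc ` y ` (A - B)" using assms(3) by (force simp: Pi_iff)
  moreover have "card (Suc ` y ` (A - B)) = card (y ` (A - B))"
    by (intro card_image) auto
  ultimately show ?thesis using assms by (auto simp: put_first_image)
qed

text \<open>Box 1 has the balls of \<open>B\<close> in it and those of \<open>A - B\<close> beyond
  it; at every later box the counts are those of \<open>y\<close> one index lower.\<close>

lemma allocation_weight_put_first:
  assumes "finite A" "B \<subseteq> A" "A \<noteq> {}" "y \<in> (A - B) \<rightarrow> {1..}"
  shows "allocation_weight \<mu> A (put_first A B y) =
           \<mu> (card (A - B)) (card B) * allocation_weight \<mu> (A - B) y"
proof -
  let ?x = "put_first A B y" and ?t = "top_box (A - B) y"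
  let ?g = "\<lambda>k. \<mu> (card {i\<in>A. k < ?x i}) (card {i\<in>A. ?x i = k})"
  have pos: "1 \<le> y i" if "i \<in> A - B" for i using assms(4) that by auto
  have 1: "{i\<in>A. 1 < ?x i} = A - B" "{i\<in>A. ?x i = 1} = B"
    using assms(2) pos by (force simp: put_first_def)+
  have 2: "{i\<in>A. Suc k < ?x i} = {i\<in>A - B. k < y i}"
       "{i\<in>A. ?x i = Suc k} = {i\<in>A - B. y i = k}" if "k \<ge> 1" for k
    using that by (auto simp: put_first_def)
  have "allocation_weight \<mu> A ?x = (\<Prod>k\<in>{1..Suc ?t}. ?g k)"
    using assms by (simp add: allocation_weight_def top_box_put_first)
  also have "\<dots> = ?g 1 * (\<Prod>k\<in>{Suc 1..Suc ?t}. ?g k)"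
    by (rule prod.atLeast_Suc_atMost) simp
  also have "(\<Prod>k\<in>{Suc 1..Suc ?t}. ?g k) = (\<Prod>k\<in>{1..?t}. ?g (Suc k))"
    by (rule prod.shift_bounds_cl_Suc_ivl)
  also have "\<dots> = allocation_weight \<mu> (A - B) y"
    unfolding allocation_weight_def by (intro prod.cong refl) (simp add: 2)
  finally show ?thesis by (simp only: 1)
qed

lemma bij_betw_put_first:
  assumes "finite A" "B \<subseteq> A" "A \<noteq> {}" and k: "B = {} \<Longrightarrow> k = Suc l" "B \<noteq> {} \<Longrightarrow> k = l"
  shows "bij_betw (put_first A B) (allocations (A - B) l)
           {x \<in> allocations A k. {i\<in>A. x i = 1} = B}"
\<comment> \<open>The inverse deletes box 1 and renumbers. Balls outside \<open>B\<close> sit in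
  boxes from 2 on, so the subtraction does not truncate.\<close>
proof (rule bij_betw_byWitness[where f' = "\<lambda>x. \<lambda>i\<in>A - B. x i - 1"])
  have first: "{i\<in>A. put_first A B y i = 1} = B" if "y \<in> (A - B) \<rightarrow> {1..}" for y
    using assms(2) that by (force simp: put_first_def)
  have inv: "put_first A B (\<lambda>i\<in>A - B. x i - 1) = x"
    if "x \<in> A \<rightarrow>\<^sub>E {1..}" "{i\<in>A. x i = 1} = B" for x
  proof
    fix i
    show "put_first A B (\<lambda>i\<in>A - B. x i - 1) i = x i"
      using that by (cases "i \<in> A") (auto simp: put_first_def PiE_iff extensional_def Suc_le_eq)
  qed
  \<comment> \<open>One direction shows that \<open>put_first\<close> lands in the target; the
    other, combined with \<open>inv\<close>, does the same for the inverse map.\<close>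
  have iff: "put_first A B y \<in> allocations A k \<longleftrightarrow> y \<in> allocations (A - B) l"
    if "y \<in> (A - B) \<rightarrow>\<^sub>E {1..}" for y
  proof -
    have "put_first A B y \<in> A \<rightarrow>\<^sub>E {1..}" by (auto simp: put_first_def)
    moreover have "y \<in> (A - B) \<rightarrow> {1..}" using that by auto
    ultimately show ?thesis
      using that k assms(1-3)
      by (cases "B = {}") (auto simp: allocations_def top_box_put_first card_put_first_image)
  qed
  show "\<forall>y\<in>allocations (A - B) l. (\<lambda>i\<in>A - B. put_first A B y i - 1) = y"
  proof (intro ballI ext)
    fix y i assume "y \<in> allocations (A - B) l"
    then show "(\<lambda>i\<in>A - B. put_first A B y i - 1) i = y i"
      by (auto simp: put_first_def allocations_def PiE_iff extensional_def)
  qed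
  show "\<forall>x\<in>{x \<in> allocations A k. {i\<in>A. x i = 1} = B}.
          put_first A B (\<lambda>i\<in>A - B. x i - 1) = x"
    using inv by (auto simp: allocations_def)
  show "put_first A B ` allocations (A - B) l \<subseteq> {x \<in> allocations A k. {i\<in>A. x i = 1} = B}"
  proof (intro image_subsetI)
    fix y assume y: "y \<in> allocations (A - B) l"
    then have "y \<in> (A - B) \<rightarrow>\<^sub>E {1..}" by (simp add: allocations_def)
    moreover from this have "y \<in> (A - B) \<rightarrow> {1..}" by auto
    ultimately show "put_first A B y \<in> {x \<in> allocations A k. {i\<in>A. x i = 1} = B}"
      using y iff first by blast
  qed
  show "(\<lambda>x. \<lambda>i\<in>A - B. x i - 1) ` {x \<in> allocations A k. {i\<in>A. x i = 1} = B}
          \<subseteq> allocations (A - B) l"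
  proof (intro image_subsetI)
    fix x assume x: "x \<in> {x \<in> allocations A k. {i\<in>A. x i = 1} = B}"
    then have PiE: "x \<in> A \<rightarrow>\<^sub>E {1..}" and B: "{i\<in>A. x i = 1} = B"
      by (auto simp: allocations_def)
    have "x i - 1 \<ge> 1" if "i \<in> A - B" for i
    proof -
      have "x i \<ge> 1" "x i \<noteq> 1" using PiE B that by auto
      then show ?thesis by linarith
    qed
    then have "(\<lambda>i\<in>A - B. x i - 1) \<in> (A - B) \<rightarrow>\<^sub>E {1..}" by auto
    from iff[OF this] show "(\<lambda>i\<in>A - B. x i - 1) \<in> allocations (A - B) l"
      using inv[OF PiE B] x by simp
  qed
qed

section \<open>The recursion and its geometric solution\<close>

lemma sum_allocations_first_box:
  assumes "finite A" "B \<subseteq> A" "A \<noteq> {}" "B = {} \<Longrightarrow> k = Suc l" "B \<noteq> {} \<Longrightarrow> k = l"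
  shows "(\<Sum>x\<in>{x \<in> allocations A k. {i\<in>A. x i = 1} = B}. allocation_weight \<mu> A x) =
    \<mu> (card (A - B)) (card B) * (\<Sum>y\<in>allocations (A - B) l. allocation_weight \<mu> (A - B) y)"
proof -
  have "(\<Sum>x\<in>{x \<in> allocations A k. {i\<in>A. x i = 1} = B}. allocation_weight \<mu> A x) =
     (\<Sum>y\<in>allocations (A - B) l. allocation_weight \<mu> A (put_first A B y))"
    using sum.reindex_bij_betw[OF bij_betw_put_first[OF assms], symmetric] by simp
  also have "\<dots> = (\<Sum>y\<in>allocations (A - B) l.
      \<mu> (card (A - B)) (card B) * allocation_weight \<mu> (A - B) y)"
    using assms(1-3)
    by (intro sum.cong refl allocation_weight_put_first) (auto simp: allocations_def PiE_iff)
  finally show ?thesis by (simp add: sum_distrib_left)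
qed

text \<open>If box 1 is empty, the occupied boxes lie in \<open>{2..top_box A x}\<close>, so they
  are fewer than the top index and some box is missed.\<close>

lemma allocations_no_first_box:
  assumes "finite A" "A \<noteq> {}"
  shows "{x \<in> allocations A 0. {i\<in>A. x i = 1} = {}} = {}"
proof -
  have False if x: "x \<in> allocations A 0" and none: "{i\<in>A. x i = 1} = {}" for x
  proof -
    have "x i \<in> {2..top_box A x}" if "i \<in> A" for i
    proof -
      have "x i \<ge> 1" "x i \<noteq> 1" using x none that by (auto simp: allocations_def)
      moreover have "x i \<le> top_box A x"
        using that assms by (auto simp: top_box_def)
      ultimately show ?thesis by auto
    qed
    then have sub: "x ` A \<subseteq> {2..top_box A x}" by blast
    then have "card (x ` A) \<le> card {2..top_box A x}" by (intro card_mono) auto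
    \<comment> \<open>This makes the interval strictly smaller than the top index; with top box 0
      both numbers would be 0.\<close>
    moreover have "top_box A x \<ge> 2" using sub assms(2) by fastforce
    ultimately show False using x by (simp add: allocations_def)
  qed
  then show ?thesis by blast
qed

text \<open>Allocations are grouped by the set \<open>B\<close> of balls in box 1. The term for
  \<open>B = {}\<close> keeps all balls but uses up one empty box, so there \<open>k\<close>
  decreases instead of \<open>A\<close>.\<close>

lemma sum_allocations_rec:
  fixes \<mu> :: "nat \<Rightarrow> nat \<Rightarrow> real"
  defines "T \<equiv> \<lambda>A k. \<Sum>x\<in>allocations A k. allocation_weight \<mu> A x"
  assumes "finite A" "A \<noteq> {}"
  shows "T A k = (\<Sum>B\<in>Pow A - {{}}. \<mu> (card (A - B)) (card B) * T (A - B) k)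
           + \<mu> (card A) 0 * (case k of 0 \<Rightarrow> 0 | Suc l \<Rightarrow> T A l)"
proof -
  let ?S = "\<lambda>B. \<Sum>x\<in>{x \<in> allocations A k. {i\<in>A. x i = 1} = B}. allocation_weight \<mu> A x"
  have "T A k = (\<Sum>B\<in>Pow A. ?S B)"
    unfolding T_def using assms
    by (intro sum.group[symmetric] finite_allocations) auto
  also have "\<dots> = ?S {} + (\<Sum>B\<in>Pow A - {{}}. ?S B)"
    using assms by (intro sum.remove) auto
  also have "(\<Sum>B\<in>Pow A - {{}}. ?S B) =
      (\<Sum>B\<in>Pow A - {{}}. \<mu> (card (A - B)) (card B) * T (A - B) k)"
    unfolding T_def using assms by (intro sum.cong refl sum_allocations_first_box) auto
  also have "?S {} = \<mu> (card A) 0 * (case k of 0 \<Rightarrow> 0 | Suc l \<Rightarrow> T A l)"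
  proof (cases k)
    case 0
    then show ?thesis
      by (simp only: allocations_no_first_box[OF assms(2,3)] sum.empty nat.case mult_zero_right)
  next
    case (Suc l)
    then show ?thesis
      using sum_allocations_first_box[of A "{}" k l \<mu>] assms by (simp add: T_def)
  qed
  finally show ?thesis by simp
qed

text \<open>Two nested inductions match the recursion: over the set of balls when box 1 is occupied,
  and over \<open>k\<close> when it is empty.\<close>

lemma sum_allocations_geometric:
  fixes \<mu> :: "nat \<Rightarrow> nat \<Rightarrow> real"
  assumes sym: "\<And>a b. \<mu> a b = \<mu> b a"
    and total: "\<And>A :: 'i set. finite A \<Longrightarrow> (\<Sum>B\<in>Pow A. \<mu> (card (A - B)) (card B)) = 1"
    and "finite (A :: 'i set)" "A \<noteq> {}"
  shows "(\<Sum>x\<in>allocations A k. allocation_weight \<mu> A x) = (1/2) ^ (k + 1)"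
  using assms(3,4)
proof (induction A arbitrary: k rule: finite_psubset_induct)
  case (psubset A)
  define T where "T = (\<lambda>(A :: 'i set) k. \<Sum>x\<in>allocations A k. allocation_weight \<mu> A x)"
  define q where "q = \<mu> (card A) 0"
  let ?w = "\<lambda>B. \<mu> (card (A - B)) (card B)"
  \<comment> \<open>The term \<open>B = A\<close> is isolated because it leaves no balls, a case
    outside the induction hypothesis.\<close>
  have split: "(\<Sum>B\<in>Pow A - {{}}. f B) = f A + (\<Sum>B\<in>Pow A - {{}} - {A}. f B)"
    for f :: "'i set \<Rightarrow> real"
    using psubset.hyps psubset.prems by (intro sum.remove) auto
  have "(\<Sum>B\<in>Pow A. ?w B) = ?w {} + (\<Sum>B\<in>Pow A - {{}}. ?w B)"
    using psubset.hyps by (intro sum.remove) auto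
  \<comment> \<open>By symmetry \<open>B = {}\<close> and \<open>B = A\<close> both have weight
    \<open>q\<close>, and all weights sum to 1.\<close>
  then have inner: "(\<Sum>B\<in>Pow A - {{}} - {A}. ?w B) = 1 - 2 * q"
    using total[OF psubset.hyps(1)] split[of ?w] sym[of 0 "card A"] by (simp add: q_def)
  \<comment> \<open>Without balls there are surely 0 empty boxes, so this law is a point mass and
    not geometric.\<close>
  have empty: "T {} k = (if k = 0 then 1 else 0)" for k
    by (simp add: T_def allocations_empty allocation_weight_def top_box_def)
  have rec: "T A k = q * (if k = 0 then 1 else 0) + (1 - 2 * q) * (1/2) ^ (k + 1)
      + q * (case k of 0 \<Rightarrow> 0 | Suc l \<Rightarrow> T A l)" for k
  proof -
    have "(\<Sum>B\<in>Pow A - {{}} - {A}. ?w B * T (A - B) k) =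
        (\<Sum>B\<in>Pow A - {{}} - {A}. ?w B * (1/2) ^ (k + 1))"
    proof (intro sum.cong refl arg_cong2[where f = "(*)"])
      fix B assume "B \<in> Pow A - {{}} - {A}"
      then show "T (A - B) k = (1/2) ^ (k + 1)"
        unfolding T_def by (intro psubset.IH) auto
    qed
    also have "\<dots> = (1 - 2 * q) * (1/2) ^ (k + 1)"
      by (simp only: sum_distrib_right[symmetric] inner)
    finally have inner_T: "(\<Sum>B\<in>Pow A - {{}} - {A}. ?w B * T (A - B) k) =
        (1 - 2 * q) * (1/2) ^ (k + 1)" .
    have "T A k = (\<Sum>B\<in>Pow A - {{}}. ?w B * T (A - B) k)
        + q * (case k of 0 \<Rightarrow> 0 | Suc l \<Rightarrow> T A l)"
      unfolding T_def q_def by (rule sum_allocations_rec[OF psubset.hyps(1) psubset.prems])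
    then show ?thesis
      unfolding split[of "\<lambda>B. ?w B * T (A - B) k"] inner_T
      by (simp add: empty q_def sym[of 0 "card A"])
  qed
  have "T A k = (1/2) ^ (k + 1)"
  proof (induction k)
    case 0
    \<comment> \<open>At 0 the recursion reads \<open>q + (1 - 2 * q) / 2 = 1 / 2\<close>; in the
      next step the terms with \<open>q\<close> cancel.\<close>
    show ?case using rec[of 0] by (simp add: field_simps)
  next
    case (Suc k)
    show ?case using rec[of "Suc k"] Suc by (simp add: field_simps)
  qed
  then show ?case by (simp add: T_def)
qed

section \<open>The law of an allocation\<close>

text \<open>Exponents 0 and 1 let the frequencies of all boxes up to \<open>t\<close> be products
  over the same range, so that several balls can be multiplied factor by factor.\<close>

lemma freq_eq_prod:
  assumes "1 \<le> k" "k \<le> t"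
  shows "freq Ws k \<omega> =
    (\<Prod>j\<in>{1..t}. Ws j \<omega> ^ (if j < k then 1 else 0) * (1 - Ws j \<omega>) ^ (if k = j then 1 else 0))"
proof -
  have "(\<Prod>j\<in>{1..t}. Ws j \<omega> ^ (if j < k then 1 else 0)) = (\<Prod>j\<in>{1..<k}. Ws j \<omega>)"
    using assms by (intro prod.mono_neutral_cong_right) auto
  moreover have "(\<Prod>j\<in>{1..t}. (1 - Ws j \<omega>) ^ (if k = j then 1 else 0)) = (\<Prod>j\<in>{k}. 1 - Ws j \<omega>)"
    using assms by (intro prod.mono_neutral_cong_right) auto
  ultimately show ?thesis by (simp add: freq_def prod.distrib)
qed

text \<open>Exchanging the products over balls and boxes turns the 0-1 exponents of each factor into
  counts of balls.\<close>

lemma prod_freq_eq: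
  assumes "finite A" "\<And>i. i \<in> A \<Longrightarrow> 1 \<le> x i \<and> x i \<le> t"
  shows "(\<Prod>i\<in>A. freq Ws (x i) \<omega>) =
    (\<Prod>j\<in>{1..t}. Ws j \<omega> ^ card {i\<in>A. j < x i} * (1 - Ws j \<omega>) ^ card {i\<in>A. x i = j})"
proof -
  have "(\<Prod>i\<in>A. freq Ws (x i) \<omega>) = (\<Prod>i\<in>A. \<Prod>j\<in>{1..t}.
      Ws j \<omega> ^ (if j < x i then 1 else 0) * (1 - Ws j \<omega>) ^ (if x i = j then 1 else 0))"
    using assms by (intro prod.cong refl freq_eq_prod) auto
  also have "\<dots> = (\<Prod>j\<in>{1..t}. \<Prod>i\<in>A.
      Ws j \<omega> ^ (if j < x i then 1 else 0) * (1 - Ws j \<omega>) ^ (if x i = j then 1 else 0))"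
    by (rule prod.swap)
  also have "\<dots> = (\<Prod>j\<in>{1..t}.
      Ws j \<omega> ^ card {i\<in>A. j < x i} * (1 - Ws j \<omega>) ^ card {i\<in>A. x i = j})"
    using assms(1)
    by (intro prod.cong refl)
       (simp add: prod.distrib power_sum[symmetric] sum.If_cases Int_def conj_commute)
  finally show ?thesis .
qed

context bernoulli_sieve
begin

lemma measurable_Ws: "k \<ge> 1 \<Longrightarrow> Ws k \<in> borel_measurable M"
  using indep_Ws by (auto simp: indep_vars_def2)

lemma measurable_X: "i \<ge> 1 \<Longrightarrow> X i \<in> measurable M (count_space {1..})"
  using cond_indep_balls by (auto simp: cond_indep_vars_def)

lemma sets_allocation:
  assumes "finite A" "A \<subseteq> {1..}" "x \<in> A \<rightarrow> {1..}"
  shows "{\<omega> \<in> space M. \<forall>i\<in>A. X i \<omega> = x i} \<in> sets M"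
proof (rule sets.sets_Collect_finite_All[OF _ assms(1)])
  fix i assume i: "i \<in> A"
  have "{\<omega> \<in> space M. X i \<omega> = x i} = X i -` {x i} \<inter> space M" by auto
  also have "\<dots> \<in> sets M"
    using i assms(2,3) by (intro measurable_sets[OF measurable_X]) (auto simp: Pi_iff)
  finally show "{\<omega> \<in> space M. X i \<omega> = x i} \<in> sets M" .
qed

lemma subalgebra_env: "subalgebra M (env_algebra M Ws)"
  unfolding subalgebra_def
proof
  have "(\<lambda>\<omega>. \<lambda>k\<in>{1..}. Ws k \<omega>) \<in> measurable M (\<Pi>\<^sub>M k\<in>{1..}. (borel :: real measure))"
    by (intro measurable_restrict measurable_Ws) auto
  then show "sets (env_algebra M Ws) \<subseteq> sets M"
    unfolding env_algebra_def by (intro sets_image_in_sets) auto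
qed (simp add: env_algebra_def)

text \<open>Conditional independence, applied to the singletons \<open>{x i}\<close>, makes the
  conditional probability given the factors a product of frequencies; taking expectations removes
  the conditioning.\<close>

lemma prob_allocation_eq_expectation:
  assumes "finite A" "A \<subseteq> {1..}" "x \<in> A \<rightarrow> {1..}"
  shows "prob {\<omega> \<in> space M. \<forall>i\<in>A. X i \<omega> = x i} = expectation (\<lambda>\<omega>. \<Prod>i\<in>A. freq Ws (x i) \<omega>)"
proof -
  interpret finite_measure_subalgebra M "env_algebra M Ws"
    by unfold_locales (rule subalgebra_env)
  let ?E = "{\<omega> \<in> space M. \<forall>i\<in>A. X i \<omega> = x i}"
  have E: "?E \<in> sets M" using assms by (rule sets_allocation)
  have "AE \<omega> in M. real_cond_exp M (env_algebra M Ws)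
        (indicator {\<omega> \<in> space M. \<forall>i\<in>A. X i \<omega> \<in> {x i}}) \<omega> =
      (\<Prod>i\<in>A. real_cond_exp M (env_algebra M Ws)
        (indicator {\<omega> \<in> space M. X i \<omega> \<in> {x i}}) \<omega>)"
    using cond_indep_balls assms unfolding cond_indep_vars_def
    by (elim conjE allE[of _ A] allE[of _ "\<lambda>i. {x i}"]) auto
  moreover have "AE \<omega> in M. \<forall>i\<in>A. real_cond_exp M (env_algebra M Ws)
      (indicator {\<omega> \<in> space M. X i \<omega> = x i}) \<omega> = freq Ws (x i) \<omega>"
    using assms by (intro AE_finite_allI cond_prob_ball) auto
  ultimately have ae: "AE \<omega> in M. real_cond_exp M (env_algebra M Ws) (indicator ?E) \<omega> =
      (\<Prod>i\<in>A. freq Ws (x i) \<omega>)"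
    by eventually_elim simp
  have "prob ?E = expectation (indicator ?E)" using E by simp
  also have "\<dots> = expectation (real_cond_exp M (env_algebra M Ws) (indicator ?E))"
    using E by (intro real_cond_exp_int(2)[symmetric]) (simp add: emeasure_eq_measure)
  also have "\<dots> = expectation (\<lambda>\<omega>. \<Prod>i\<in>A. freq Ws (x i) \<omega>)"
  proof (rule integral_cong_AE[OF _ _ ae])
    have "freq Ws (x i) \<in> borel_measurable M" if "i \<in> A" for i
      unfolding freq_def using that assms
      by (intro borel_measurable_times borel_measurable_prod borel_measurable_diff
          measurable_Ws) auto
    then show "(\<lambda>\<omega>. \<Prod>i\<in>A. freq Ws (x i) \<omega>) \<in> borel_measurable M"
      by (intro borel_measurable_prod) auto
  qed simp
  finally show ?thesis .
qed

lemma expectation_Ws: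
  fixes f :: "real \<Rightarrow> real"
  assumes "k \<ge> 1" "W \<in> borel_measurable N" "f \<in> borel_measurable borel"
  shows "expectation (\<lambda>\<omega>. f (Ws k \<omega>)) = (\<integral>x. f (W x) \<partial>N)"
  using integral_distr[OF measurable_Ws[OF assms(1)] assms(3)]
    integral_distr[OF assms(2,3)] distr_Ws[OF assms(1)] by simp

lemma AE_Ws:
  assumes "k \<ge> 1" "W \<in> borel_measurable N" "AE x in N. 0 < W x \<and> W x < 1"
  shows "AE \<omega> in M. 0 < Ws k \<omega> \<and> Ws k \<omega> < 1"
proof -
  have "AE y in distr N borel W. 0 < y \<and> y < 1"
    using assms by (subst AE_distr_iff) auto
  then show ?thesis
    using assms measurable_Ws[OF assms(1)]
    by (subst (asm) distr_Ws[OF assms(1), symmetric], subst (asm) AE_distr_iff) auto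
qed

text \<open>Once the frequencies are regrouped by boxes, each factor \<open>Ws j\<close> occurs in a
  single term, so independence splits the expectation into mixed moments of
  \<open>W\<close>.\<close>

lemma prob_allocation:
  assumes "finite A" "A \<subseteq> {1..}" "x \<in> A \<rightarrow> {1..}"
    and "W \<in> borel_measurable N" "AE x in N. 0 < W x \<and> W x < 1"
  shows "prob {\<omega> \<in> space M. \<forall>i\<in>A. X i \<omega> = x i} =
           allocation_weight (\<lambda>a b. \<integral>w. W w ^ a * (1 - W w) ^ b \<partial>N) A x"
proof -
  define g where "g j w = w ^ card {i\<in>A. j < x i} * (1 - w) ^ card {i\<in>A. x i = j}"
    for j and w :: real
  have g: "g j \<in> borel_measurable borel" for j unfolding g_def by measurable
  have "(\<Prod>i\<in>A. freq Ws (x i) \<omega>) = (\<Prod>j\<in>{1..top_box A x}. g j (Ws j \<omega>))" for \<omega>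
    unfolding g_def using assms by (intro prod_freq_eq) (auto simp: top_box_def)
  then have "prob {\<omega> \<in> space M. \<forall>i\<in>A. X i \<omega> = x i} =
      expectation (\<lambda>\<omega>. \<Prod>j\<in>{1..top_box A x}. g j (Ws j \<omega>))"
    using prob_allocation_eq_expectation[OF assms(1-3)] by simp
  also have "\<dots> = (\<Prod>j\<in>{1..top_box A x}. expectation (\<lambda>\<omega>. g j (Ws j \<omega>)))"
  \<comment> \<open>For top box 0 both products are empty, and the claim is that \<open>M\<close>
    has total mass 1.\<close>
  proof (cases "top_box A x = 0")
    case True
    then show ?thesis by (simp add: prob_space)
  next
    case False
    show ?thesis
    proof (rule indep_vars_lebesgue_integral)
      have "indep_vars (\<lambda>_. borel) Ws {1..top_box A x}"
        by (rule indep_vars_subset[OF indep_Ws]) auto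
      then show "indep_vars (\<lambda>_. borel) (\<lambda>j \<omega>. g j (Ws j \<omega>)) {1..top_box A x}"
        by (rule indep_vars_compose2) (rule g)
      fix j assume "j \<in> {1..top_box A x}"
      then have j: "j \<ge> 1" by simp
      \<comment> \<open>Integrability comes from boundedness, since the factors lie in (0,1) almost
        everywhere.\<close>
      have "AE \<omega> in M. norm (g j (Ws j \<omega>)) \<le> 1"
        using AE_Ws[OF j assms(4,5)]
        by eventually_elim (auto simp: g_def abs_mult power_abs intro!: mult_le_one power_le_one)
      then show "integrable M (\<lambda>\<omega>. g j (Ws j \<omega>))"
        using measurable_compose[OF measurable_Ws[OF j] g] by (rule integrable_const_bound)
    qed simp
  qed
  also have "\<dots> = allocation_weight (\<lambda>a b. \<integral>w. W w ^ a * (1 - W w) ^ b \<partial>N) A x"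
    unfolding allocation_weight_def
    using expectation_Ws[OF _ assms(4) g] by (intro prod.cong refl) (simp add: g_def)
  finally show ?thesis .
qed

section \<open>The law of the number of empty boxes\<close>

lemma prob_num_empty:
  assumes "n \<ge> 1" "W \<in> borel_measurable N" "AE x in N. 0 < W x \<and> W x < 1"
  shows "prob {\<omega> \<in> space M. num_empty X n \<omega> = k} =
    (\<Sum>x\<in>allocations {1..n} k.
       allocation_weight (\<lambda>a b. \<integral>w. W w ^ a * (1 - W w) ^ b \<partial>N) {1..n} x)"
proof -
  define E where "E x = {\<omega> \<in> space M. \<forall>i\<in>{1..n}. X i \<omega> = x i}" for x
  have Xpos: "X i \<omega> \<ge> 1" if "\<omega> \<in> space M" "i \<ge> 1" for i \<omega>
    using measurable_space[OF measurable_X[OF that(2)] that(1)] by simp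
  have top: "top_box {1..n} x = Max (x ` {1..n})" for x
    unfolding top_box_def using assms(1) by (subst Max_insert) auto
  have mem: "(\<lambda>i\<in>{1..n}. X i \<omega>) \<in> allocations {1..n} k \<longleftrightarrow> num_empty X n \<omega> = k"
    if "\<omega> \<in> space M" for \<omega>
  proof -
    let ?R = "(\<lambda>i. X i \<omega>) ` {1..n}"
    \<comment> \<open>Hence the subtraction in \<open>num_empty\<close> does not truncate and agrees
      with the additive condition in \<open>allocations\<close>.\<close>
    have "?R \<subseteq> {1..Max ?R}" using Xpos[OF that] by auto
    from card_mono[OF _ this] have "card ?R \<le> Max ?R" by simp
    moreover have "(\<lambda>i\<in>{1..n}. X i \<omega>) \<in> {1..n} \<rightarrow>\<^sub>E {1..}" using Xpos[OF that] by auto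
    moreover have "top_box {1..n} (\<lambda>i\<in>{1..n}. X i \<omega>) = Max ?R"
      using top[of "\<lambda>i\<in>{1..n}. X i \<omega>"] by simp
    ultimately show ?thesis
      by (auto simp: allocations_def num_empty_def max_occupied_def num_occupied_def
          occupied_boxes_def)
  qed
  \<comment> \<open>The event is cut into finitely many disjoint events, one for each complete
    allocation of the \<open>n\<close> balls.\<close>
  have "{\<omega> \<in> space M. num_empty X n \<omega> = k} = (\<Union>x\<in>allocations {1..n} k. E x)"
  proof (intro equalityI subsetI)
    fix \<omega> assume "\<omega> \<in> {\<omega> \<in> space M. num_empty X n \<omega> = k}"
    then show "\<omega> \<in> (\<Union>x\<in>allocations {1..n} k. E x)"
      using mem[of \<omega>] by (intro UN_I[of "\<lambda>i\<in>{1..n}. X i \<omega>"]) (auto simp: E_def)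
  next
    fix \<omega> assume "\<omega> \<in> (\<Union>x\<in>allocations {1..n} k. E x)"
    then obtain x where x: "x \<in> allocations {1..n} k" "\<omega> \<in> E x" by blast
    then have "(\<lambda>i\<in>{1..n}. X i \<omega>) = x"
      by (intro ext) (auto simp: E_def allocations_def PiE_iff extensional_def)
    then show "\<omega> \<in> {\<omega> \<in> space M. num_empty X n \<omega> = k}"
      using x mem[of \<omega>] by (auto simp: E_def)
  qed
  also have "prob \<dots> = (\<Sum>x\<in>allocations {1..n} k. prob (E x))"
  proof (rule finite_measure_finite_Union)
    show "finite (allocations {1..n} k)" by (rule finite_allocations) simp
    show "disjoint_family_on E (allocations {1..n} k)"
      unfolding disjoint_family_on_def
    proof (intro ballI impI)
      fix x y assume xy: "x \<in> allocations {1..n} k" "y \<in> allocations {1..n} k" "x \<noteq> y"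
      then obtain i where "i \<in> {1..n}" "x i \<noteq> y i"
        unfolding allocations_def by (metis (no_types, lifting) PiE_ext mem_Collect_eq)
      then show "E x \<inter> E y = {}" by (auto simp: E_def)
    qed
    show "E ` allocations {1..n} k \<subseteq> sets M"
    proof (intro image_subsetI)
      fix x assume "x \<in> allocations {1..n} k"
      then have x: "x \<in> {1..n} \<rightarrow> {1..}" by (auto simp: allocations_def)
      then show "E x \<in> sets M" unfolding E_def by (intro sets_allocation) auto
    qed
  qed
  also have "\<dots> = (\<Sum>x\<in>allocations {1..n} k.
      allocation_weight (\<lambda>a b. \<integral>w. W w ^ a * (1 - W w) ^ b \<partial>N) {1..n} x)"
    unfolding E_def using assms
    by (intro sum.cong refl prob_allocation) (auto simp: allocations_def)
  finally show ?thesis .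
qed

end

section \<open>The mixed moments\<close>

text \<open>Replacing \<open>W\<close> by \<open>1 - W\<close>, which has the same law, interchanges
  the two factors.\<close>

lemma mixed_moment_symmetric:
  fixes W :: "'b \<Rightarrow> real"
  assumes "W \<in> borel_measurable N" "distr N borel W = distr N borel (\<lambda>x. 1 - W x)"
  shows "(\<integral>w. W w ^ a * (1 - W w) ^ b \<partial>N) = (\<integral>w. W w ^ b * (1 - W w) ^ a \<partial>N)"
proof -
  have f: "(\<lambda>w. w ^ a * (1 - w) ^ b) \<in> borel_measurable (borel :: real measure)" by measurable
  have "(\<integral>w. W w ^ a * (1 - W w) ^ b \<partial>N) = (\<integral>w. (1 - W w) ^ a * (1 - (1 - W w)) ^ b \<partial>N)"
    using integral_distr[OF assms(1) f] integral_distr[OF _ f, of "\<lambda>x. 1 - W x" N] assms by simp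
  then show ?thesis by (simp add: mult.commute)
qed

text \<open>Pointwise this is the expansion over subsets of the product of
  \<open>(1 - W) + W = 1\<close> over all balls; boundedness allows summing under the
  integral.\<close>

lemma sum_mixed_moments:
  fixes W :: "'b \<Rightarrow> real"
  assumes "prob_space N" "W \<in> borel_measurable N" "AE x in N. 0 < W x \<and> W x < 1" "finite A"
  shows "(\<Sum>B\<in>Pow A. \<integral>w. W w ^ card (A - B) * (1 - W w) ^ card B \<partial>N) = 1"
proof -
  interpret prob_space N by fact
  have int: "integrable N (\<lambda>w. W w ^ a * (1 - W w) ^ b)" for a b
  proof (rule integrable_const_bound)
    show "AE w in N. norm (W w ^ a * (1 - W w) ^ b) \<le> 1"
      using assms(3)
      by eventually_elim (auto simp: abs_mult power_abs intro!: mult_le_one power_le_one)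
  qed (use assms(2) in measurable)
  have "(\<Sum>B\<in>Pow A. \<integral>w. W w ^ card (A - B) * (1 - W w) ^ card B \<partial>N) =
      (\<integral>w. (\<Sum>B\<in>Pow A. W w ^ card (A - B) * (1 - W w) ^ card B) \<partial>N)"
    by (rule Bochner_Integration.integral_sum[symmetric]) (rule int)
  also have "\<dots> = (\<integral>w. 1 \<partial>N)"
    using prod_add[OF assms(4), of "\<lambda>_. 1 - W w" "\<lambda>_. W w" for w, symmetric]
    by (intro Bochner_Integration.integral_cong refl) (simp add: mult.commute)
  finally show ?thesis by (simp add: prob_space)
qed

theorem proposition7p3:
  fixes N :: "'b measure" and W :: "'b \<Rightarrow> real"
    and M :: "'a measure" and Ws :: "nat \<Rightarrow> 'a \<Rightarrow> real" and X :: "nat \<Rightarrow> 'a \<Rightarrow> nat"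
  assumes "prob_space N"
    and "W \<in> borel_measurable N"
    and "\<And>x. x \<in> space N \<Longrightarrow> 0 < W x \<and> W x < 1"
    and "non_lattice (distr N borel (\<lambda>x. \<bar>ln (W x)\<bar>))"
    and "bernoulli_sieve N W M Ws X"
    and "distr N borel W = distr N borel (\<lambda>x. 1 - W x)"
  shows "\<forall>n\<ge>1. \<forall>k. measure M {\<omega> \<in> space M. num_empty X n \<omega> = k} = (1/2) ^ (k + 1)"
proof (intro allI impI)
  fix n k :: nat assume n: "n \<ge> 1"
  have ae: "AE x in N. 0 < W x \<and> W x < 1" using assms(3) by (intro AE_I2)
  have "measure M {\<omega> \<in> space M. num_empty X n \<omega> = k} =
    (\<Sum>x\<in>allocations {1..n} k.
       allocation_weight (\<lambda>a b. \<integral>w. W w ^ a * (1 - W w) ^ b \<partial>N) {1..n} x)"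
    by (rule bernoulli_sieve.prob_num_empty[OF assms(5) n assms(2) ae])
  also have "\<dots> = (1/2) ^ (k + 1)"
    using n by (intro sum_allocations_geometric mixed_moment_symmetric assms(2,6)
        sum_mixed_moments[OF assms(1,2) ae]) auto
  finally show "measure M {\<omega> \<in> space M. num_empty X n \<omega> = k} = (1/2) ^ (k + 1)" .
qed

end
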